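(* Let $G$ be a graph with maximum degree $\Delta=\Delta(G)$. If $H$ is the $\Delta$-expanded-clique graph of $G$, then $$\frac{|V(G)|\,\Delta}{\Delta+1}\le\gamma(H)\le |V(G)|.$$
   Context: All graphs are finite, simple and undirected. Let $G$ be a graph with vertex set $\{v_1,\dots,v_n\}$ and $f:V(G)\to\mathbb{N}$ a function with $f(v_i)\ge d_G(v_i)$ for every $i$. The expanded-clique graph $H$ of $(G,f)$ is the graph (unique up to isomorphism) defined as follows: $V(H)$ is the disjoint union of sets $V_1,\dots,V_n$, where $V_i$ has $f(v_i)$ vertices and forms a clique of $H$; for each edge $v_iv_j\in E(G)$ there are vertices $v_{i,j}\in V_i$ and $v_{j,i}\in V_j$ with $v_{i,j}v_{j,i}\in E(H)$, where the vertices $v_{i,j}$ (over all ordered pairs with $v_iv_j\in E(G)$) are pairwise distinct; and $H$ has no other edges. If $f(v_i)=k$ for every $i$, then $H$ is called the $k$-expanded-clique graph of $G$. $\gamma(H)$ is the minimum size of a dominating set of $H$, i.e. of a set $D\subseteq V(H)$ such that every vertex of $V(H)\setminus D$ has a neighbor in $D$. *)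

theory Defs
  imports Complex_Main "Graph_Theory.Graph_Theory"
begin

text \<open>
  A finite simple undirected graph is a \<open>pair_graph\<close>: a finite, loop-free, symmetric digraph
  whose arcs are pairs of vertices. Each undirected edge \<open>uv\<close> is represented by the two arcs
  \<open>(u, v)\<close> and \<open>(v, u)\<close>, so the out-degree of a vertex is its degree.
\<close>

abbreviation degree :: "'a pair_pre_digraph \<Rightarrow> 'a \<Rightarrow> nat" where
  "degree G v \<equiv> out_degree (with_proj G) v"

text \<open>The graph without vertices is given maximum degree 0.\<close>

definition max_degree :: "'a pair_pre_digraph \<Rightarrow> nat" where
  "max_degree G = (if pverts G = {} then 0 else Max (degree G ` pverts G))"

definition dominating_set :: "'a pair_pre_digraph \<Rightarrow> 'a set \<Rightarrow> bool" where
  "dominating_set G D \<longleftrightarrow>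
     D \<subseteq> pverts G \<and> (\<forall>v \<in> pverts G - D. \<exists>u \<in> D. (v, u) \<in> parcs G)"

definition domination_number :: "'a pair_pre_digraph \<Rightarrow> nat" where
  "domination_number G = Min (card ` {D. dominating_set G D})"

text \<open>
  The expanded-clique graph of \<open>(G, f)\<close> is determined up to isomorphism only, so being one is a
  property of a graph \<open>H\<close> on an arbitrary vertex type. Here \<open>V v\<close> is the clique replacing
  \<open>v\<close>, and \<open>port (u, v)\<close> is the vertex of \<open>V u\<close> (written \<open>v\<^sub>i\<^sub>,\<^sub>j\<close> if \<open>u = v\<^sub>i\<close> and
  \<open>v = v\<^sub>j\<close>) that is joined to \<open>V v\<close> on account of the edge \<open>uv\<close>. Since \<open>parcs G\<close> is
  symmetric, the second set of arcs below is symmetric as well.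
\<close>

definition expanded_clique_graph ::
    "'a pair_pre_digraph \<Rightarrow> ('a \<Rightarrow> nat) \<Rightarrow> 'b pair_pre_digraph \<Rightarrow> bool" where
  "expanded_clique_graph G f H \<longleftrightarrow>
     pair_graph H \<and>
     (\<forall>v \<in> pverts G. degree G v \<le> f v) \<and>
     (\<exists>(V :: 'a \<Rightarrow> 'b set) (port :: 'a \<times> 'a \<Rightarrow> 'b).
        pverts H = (\<Union>v \<in> pverts G. V v) \<and>
        (\<forall>u \<in> pverts G. \<forall>v \<in> pverts G. u \<noteq> v \<longrightarrow> V u \<inter> V v = {}) \<and>
        (\<forall>v \<in> pverts G. card (V v) = f v) \<and>
        (\<forall>(u, v) \<in> parcs G. port (u, v) \<in> V u) \<and>
        inj_on port (parcs G) \<and>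
        parcs H =
          {(x, y). \<exists>v \<in> pverts G. x \<in> V v \<and> y \<in> V v \<and> x \<noteq> y} \<union>
          {(port (u, v), port (v, u)) | u v. (u, v) \<in> parcs G})"

definition k_expanded_clique_graph ::
    "nat \<Rightarrow> 'a pair_pre_digraph \<Rightarrow> 'b pair_pre_digraph \<Rightarrow> bool" where
  "k_expanded_clique_graph k G H \<longleftrightarrow> expanded_clique_graph G (\<lambda>_. k) H"

lemma expanded_clique_graph_exists:
  fixes G :: "'a pair_pre_digraph"
  assumes "pair_graph G" and deg: "\<And>v. v \<in> pverts G \<Longrightarrow> degree G v \<le> f v"
  shows "\<exists>H :: ('a \<times> nat) pair_pre_digraph. expanded_clique_graph G f H"
proof -
  interpret pair_graph G by fact
  have "\<exists>e :: 'a \<times> 'a \<Rightarrow> nat. e ` out_arcs (with_proj G) v \<subseteq> {..<f v} \<and>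
      inj_on e (out_arcs (with_proj G) v)" if "v \<in> pverts G" for v
    using card_le_inj[of "out_arcs (with_proj G) v" "{..<f v}"] deg[OF that]
    by (auto simp: out_degree_def)
  then obtain e :: "'a \<Rightarrow> 'a \<times> 'a \<Rightarrow> nat"
    where e: "\<And>v. v \<in> pverts G \<Longrightarrow> e v ` out_arcs (with_proj G) v \<subseteq> {..<f v}"
      and inj: "\<And>v. v \<in> pverts G \<Longrightarrow> inj_on (e v) (out_arcs (with_proj G) v)"
    by metis
  define V where "V v = {v} \<times> {..<f v}" for v
  define port where "port a = (fst a, e (fst a) a)" for a
  define H :: "('a \<times> nat) pair_pre_digraph" where
    "H = \<lparr>pverts = (\<Union>v \<in> pverts G. V v),
          parcs = {(x, y). \<exists>v \<in> pverts G. x \<in> V v \<and> y \<in> V v \<and> x \<noteq> y} \<union>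
                  {(port (u, v), port (v, u)) | u v. (u, v) \<in> parcs G}\<rparr>"
  have port: "port (u, v) \<in> V u" if "(u, v) \<in> parcs G" for u v
    using e[OF in_arcsD1[OF that]] that by (auto simp: port_def V_def image_subset_iff)
  have inj_port: "inj_on port (parcs G)"
  proof (rule inj_onI)
    fix a b assume ab: "a \<in> parcs G" "b \<in> parcs G" "port a = port b"
    then have "fst a = fst b" "e (fst a) a = e (fst a) b"
      by (auto simp: port_def)
    with ab show "a = b"
      using inj_onD[OF inj[OF arc_fst_in_verts[OF ab(1)]]] by simp
  qed
  have fin: "finite (pverts H)"
    using pair_finite_verts by (simp add: H_def V_def)
  have sub: "parcs H \<subseteq> pverts H \<times> pverts H"
    using port arcs_symmetric by (fastforce simp: H_def dest: in_arcsD1 in_arcsD2)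
  have "pair_graph H"
  proof unfold_locales
    show "finite (parcs H)"
      using finite_subset[OF sub] fin by simp
    show "symmetric (with_proj H)"
      unfolding symmetric_def sym_def with_proj_simps H_def pair_pre_digraph.simps
      using arcs_symmetric by blast
    show "fst a \<noteq> snd a" if "a \<in> parcs H" for a
      using that no_loops' by (auto simp: H_def port_def)
  qed (use sub fin in auto)
  moreover have "V u \<inter> V v = {}" if "u \<noteq> v" for u v
    using that by (auto simp: V_def)
  moreover have "card (V v) = f v" for v
    by (simp add: V_def)
  ultimately have "expanded_clique_graph G f H"
    unfolding expanded_clique_graph_def using deg port inj_port
    by (intro conjI exI[of _ V] exI[of _ port]) (auto simp: H_def)
  then show ?thesis ..
qed

end

theory Submission
  imports Defs
begin

text \<open>
  A transversal of the cliques is dominating, which gives the upper bound. For the lower bound,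
  every closed neighborhood of \<open>H\<close> has at most \<open>\<Delta> + 1\<close> vertices (a clique and at most one vertex
  outside it), and the closed neighborhoods of a dominating set cover the \<open>|V(G)| \<Delta>\<close> vertices
  of \<open>H\<close>.
\<close>

context pair_graph
begin

lemma finite_dominating_sets: "finite {D. dominating_set G D}"
  by (rule finite_subset[of _ "Pow (pverts G)"]) (auto simp: dominating_set_def)

lemma domination_number_le:
  assumes "dominating_set G D"
  shows "domination_number G \<le> card D"
  unfolding domination_number_def using assms finite_dominating_sets by (auto intro: Min_le)

lemma domination_number_attained:
  obtains D where "dominating_set G D" "card D = domination_number G"
proof -
  have "dominating_set G (pverts G)"
    by (simp add: dominating_set_def)
  then have "domination_number G \<in> card ` {D. dominating_set G D}"
    unfolding domination_number_def using finite_dominating_sets by (intro Min_in) auto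
  then show ?thesis
    using that by auto
qed

text \<open>Union bound over a minimum dominating set. The neighborhood collects arcs into
  \<open>x\<close>, matching \<open>dominating_set\<close>, where the arc runs from the dominated
  vertex to the dominating one.\<close>

lemma card_verts_le_domination_number:
  assumes "\<And>x. x \<in> pverts G \<Longrightarrow> card (insert x {y. (y, x) \<in> parcs G}) \<le> k"
  shows "card (pverts G) \<le> domination_number G * k"
proof -
  obtain D where D: "dominating_set G D" "card D = domination_number G"
    by (rule domination_number_attained)
  let ?N = "\<lambda>x. insert x {y. (y, x) \<in> parcs G}"
  have sub: "D \<subseteq> pverts G"
    using D(1) by (simp add: dominating_set_def)
  have "?N x \<subseteq> pverts G" if "x \<in> D" for x
    using that sub by (auto dest: in_arcsD1)
  then have "finite (\<Union>x\<in>D. ?N x)"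
    by (intro finite_subset[OF _ pair_finite_verts]) blast
  moreover have "pverts G \<subseteq> (\<Union>x\<in>D. ?N x)"
    using D(1) by (auto simp: dominating_set_def)
  ultimately have "card (pverts G) \<le> card (\<Union>x\<in>D. ?N x)"
    by (rule card_mono)
  also have "\<dots> \<le> (\<Sum>x\<in>D. card (?N x))"
    using finite_subset[OF sub pair_finite_verts] by (rule card_UN_le)
  also have "\<dots> \<le> card D * k"
    using assms sub by (intro sum_bounded_above[where 'a = nat, simplified]) auto
  finally show ?thesis
    by (simp only: D(2))
qed

end

lemma domination_number_expanded_clique_graph_le:
  assumes "pair_graph G" "expanded_clique_graph G f H"
  shows "domination_number H \<le> card (pverts G)"
proof -
  interpret G: pair_graph G by fact
  interpret H: pair_graph H
    using assms(2) by (simp add: expanded_clique_graph_def)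
  obtain V :: "'a \<Rightarrow> 'b set" where V: "pverts H = (\<Union>v\<in>pverts G. V v)"
    and clique: "{(x, y). \<exists>v\<in>pverts G. x \<in> V v \<and> y \<in> V v \<and> x \<noteq> y} \<subseteq> parcs H"
    using assms(2) unfolding expanded_clique_graph_def by (elim conjE exE) auto
  \<comment> \<open>A clique is empty when \<open>f v = 0\<close>; its \<open>SOME\<close> would be
    unspecified and could lie outside \<open>H\<close>, so such \<open>v\<close> are left
    out.\<close>
  let ?D = "(\<lambda>v. SOME x. x \<in> V v) ` {v \<in> pverts G. V v \<noteq> {}}"
  have some: "(SOME x. x \<in> V v) \<in> V v" if "y \<in> V v" for v y
    using that by (rule someI)
  have "dominating_set H ?D"
    unfolding dominating_set_def
  proof (intro conjI ballI)
    show "?D \<subseteq> pverts H"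
      using some V by blast
    fix y
    assume y: "y \<in> pverts H - ?D"
    then obtain v where v: "v \<in> pverts G" "y \<in> V v"
      using V by blast
    then have "(SOME x. x \<in> V v) \<in> ?D"
      by blast
    \<comment> \<open>Since \<open>y\<close> lies outside \<open>?D\<close>, it differs from the
      representative of its clique, as a clique arc requires.\<close>
    moreover from this have "(y, SOME x. x \<in> V v) \<in> parcs H"
      using clique v y some[OF v(2)] by blast
    ultimately show "\<exists>u\<in>?D. (y, u) \<in> parcs H"
      by blast
  qed
  then have "domination_number H \<le> card ?D"
    by (rule H.domination_number_le)
  also have "\<dots> \<le> card {v \<in> pverts G. V v \<noteq> {}}"
    using G.pair_finite_verts by (intro card_image_le) simp
  also have "\<dots> \<le> card (pverts G)"
    using G.pair_finite_verts by (intro card_mono) auto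
  finally show ?thesis .
qed

text \<open>The disjoint cliques give \<open>H\<close> exactly \<open>card (pverts G) * k\<close>
  vertices, and a vertex dominates at most its clique and one port partner. The denominator is
  cleared to stay within the naturals.\<close>

lemma card_mult_le_domination_number_k_expanded_clique_graph:
  assumes "pair_graph G" "k_expanded_clique_graph k G H"
  shows "card (pverts G) * k \<le> domination_number H * (k + 1)"
proof -
  interpret G: pair_graph G by fact
  interpret H: pair_graph H
    using assms(2) by (simp add: k_expanded_clique_graph_def expanded_clique_graph_def)
  obtain V :: "'a \<Rightarrow> 'b set" and port :: "'a \<times> 'a \<Rightarrow> 'b"
    where V: "pverts H = (\<Union>v\<in>pverts G. V v)"
      and disj: "\<forall>u\<in>pverts G. \<forall>v\<in>pverts G. u \<noteq> v \<longrightarrow> V u \<inter> V v = {}"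
      and card_V: "\<forall>v\<in>pverts G. card (V v) = k"
      and inj: "inj_on port (parcs G)"
      and arcs: "parcs H = {(x, y). \<exists>v\<in>pverts G. x \<in> V v \<and> y \<in> V v \<and> x \<noteq> y} \<union>
        {(port (u, v), port (v, u)) | u v. (u, v) \<in> parcs G}"
    using assms(2) unfolding k_expanded_clique_graph_def expanded_clique_graph_def
    by (elim conjE exE) (rule that)
  \<comment> \<open>For \<open>k = 0\<close> the cardinality alone would allow an infinite
    \<open>V v\<close>, so finiteness is taken from \<open>H\<close>.\<close>
  have fin: "finite (V v)" if "v \<in> pverts G" for v
    using that V H.pair_finite_verts by (metis UN_upper finite_subset)
  have "card (pverts H) = (\<Sum>v\<in>pverts G. card (V v))"
    unfolding V using G.pair_finite_verts fin disj by (intro card_UN_disjoint) auto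
  then have card_H: "card (pverts H) = card (pverts G) * k"
    using card_V by simp
  have "card (insert x {y. (y, x) \<in> parcs H}) \<le> k + 1" if x: "x \<in> pverts H" for x
  proof -
    obtain v where v: "v \<in> pverts G" "x \<in> V v"
      using x V by blast
    \<comment> \<open>If \<open>x\<close> is the port of an arc, \<open>?z\<close> is the port of
      the reversed arc, its only possible neighbor outside \<open>V v\<close>. Otherwise
      \<open>?z\<close> is unspecified, which is harmless in an upper bound.\<close>
    let ?z = "port (prod.swap (the_inv_into (parcs G) port x))"
    have "y \<in> insert ?z (V v)" if arc: "(y, x) \<in> parcs H" for y
    proof -
      consider w where "w \<in> pverts G" "y \<in> V w" "x \<in> V w"
        | u w where "(u, w) \<in> parcs G" "y = port (u, w)" "x = port (w, u)"
        using arc unfolding arcs by auto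
      then show ?thesis
      proof cases
        case 1
        then have "w = v"
          using disj v by (metis disjoint_iff)
        then show ?thesis
          using 1 by simp
      next
        case 2
        \<comment> \<open>Injectivity of \<open>port\<close> enters here: \<open>x\<close> serves
          one arc only, so \<open>y\<close> is the partner \<open>?z\<close>.\<close>
        then have "the_inv_into (parcs G) port x = (w, u)"
          using the_inv_into_f_f[OF inj G.arcs_symmetric] by simp
        then show ?thesis
          using 2 by simp
      qed
    qed
    \<comment> \<open>Since \<open>x\<close> itself lies in \<open>V v\<close>, closing the
      neighborhood adds nothing to the bound \<open>k + 1\<close>.\<close>
    then have "insert x {y. (y, x) \<in> parcs H} \<subseteq> insert ?z (V v)"
      using v by blast
    then have "card (insert x {y. (y, x) \<in> parcs H}) \<le> card (insert ?z (V v))"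
      using fin v by (intro card_mono) auto
    also have "\<dots> \<le> k + 1"
      using fin card_V v by (simp add: card_insert_if)
    finally show ?thesis .
  qed
  then show ?thesis
    using H.card_verts_le_domination_number card_H by metis
qed

theorem theorem3p6:
  fixes G :: "'a pair_pre_digraph" and H :: "'b pair_pre_digraph"
  assumes "pair_graph G"
    and "k_expanded_clique_graph (max_degree G) G H"
  shows "real (card (pverts G)) * real (max_degree G) / (real (max_degree G) + 1)
           \<le> real (domination_number H)
         \<and> domination_number H \<le> card (pverts G)"
proof
  have "real (card (pverts G) * max_degree G) \<le> real (domination_number H * (max_degree G + 1))"
    using card_mult_le_domination_number_k_expanded_clique_graph[OF assms]
    by (simp only: of_nat_le_iff)
  then show "real (card (pverts G)) * real (max_degree G) / (real (max_degree G) + 1)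
      \<le> real (domination_number H)"
    by (simp add: pos_divide_le_eq algebra_simps)
  show "domination_number H \<le> card (pverts G)"
    using domination_number_expanded_clique_graph_le assms
    unfolding k_expanded_clique_graph_def by blast
qed

end
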